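(* Let $d\in\mathbb{N}$, $d\ge 1$, $p\in(1,\infty)$ and $m>0$ satisfy $m(p-1)>1$ and $dp>d+1$. For every $q'\in[1,\infty)$, every $C^1$-function $f:\mathbb{R}^d\to\mathbb{R}$, every $t\in[0,\infty)$ and every $x\in\mathbb{R}^d$, the dual Barenblatt flow $\mathsf{p}_\bullet$ satisfies $$|\nabla\mathsf{p}_tf(x)|^{q'}\le\mathsf{p}_t\big[|\nabla f|^{q'}\big](x).$$
   Context: Parameters: $\beta:=p+d(m(p-1)-1)$, $\gamma:=\frac{p-1}{m(p-1)-1}$, $\kappa:=\frac{m(p-1)-1}{mp}\beta^{-1/(p-1)}$, all positive. $\omega_{d-1}$ is the area of the unit sphere in $\mathbb{R}^d$ ($\omega_0=2$). For $t>0$, $r\ge 0$ let $U(t,r):=t^{-d/\beta}\,\max\{C-\kappa[t^{-1/\beta}r]^{p/(p-1)},0\}^\gamma$, where $C>0$ is the unique constant (depending only on $d,p,m$) such that $\omega_{d-1}\int_0^\infty U(t,r)r^{d-1}\,\mathrm{d}r=1$ for every $t>0$. The Barenblatt solution is $w^x(t,y):=U(t,|y-x|)$; $w^x(t,\cdot)$ is a compactly supported probability density. Barenblatt flow: for $x\in\mathbb{R}^d$ and $t\ge 0$, $\mathsf{h}_t\delta_x$ is the time-$t$ marginal law of the Leibenson process started at $x$ (a weak solution of the McKean–Vlasov SDE associated with $\partial_tu=\Delta_pu^m$), whose marginals are prescribed: $\mathsf{h}_t\delta_x=w^x(t,\cdot)\,\mathscr{L}^d$ for $t>0$ and $\mathsf{h}_0\delta_x=\delta_x$.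 Dual Barenblatt flow: for a locally bounded Borel function $f:\mathbb{R}^d\to\mathbb{R}$, $\mathsf{p}_tf(x):=\int_{\mathbb{R}^d}f\,\mathrm{d}(\mathsf{h}_t\delta_x)$. *)

theory Defs
  imports "HOL-Probability.Probability"
begin

definition grad :: "('a::real_inner \<Rightarrow> real) \<Rightarrow> 'a \<Rightarrow> 'a" where
  "grad f x = (THE D. GDERIV f x :> D)"

definition C1_function :: "('a::real_inner \<Rightarrow> real) \<Rightarrow> bool" where
  "C1_function f \<longleftrightarrow> (\<forall>x. f differentiable (at x)) \<and> continuous_on UNIV (grad f)"

(* omega_{d-1}, the area of the unit sphere in R^d: d times the volume of the unit ball,
   i.e. 2 pi^(d/2) / Gamma(d/2); it is 2 for d = 1. *)
definition sphere_area :: "nat \<Rightarrow> real" where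
  "sphere_area d = real d * unit_ball_vol (real d)"

definition barenblatt_beta :: "nat \<Rightarrow> real \<Rightarrow> real \<Rightarrow> real" where
  "barenblatt_beta d p m = p + real d * (m * (p - 1) - 1)"

definition barenblatt_gamma :: "real \<Rightarrow> real \<Rightarrow> real" where
  "barenblatt_gamma p m = (p - 1) / (m * (p - 1) - 1)"

definition barenblatt_kappa :: "nat \<Rightarrow> real \<Rightarrow> real \<Rightarrow> real" where
  "barenblatt_kappa d p m =
     (m * (p - 1) - 1) / (m * p) * barenblatt_beta d p m powr (- 1 / (p - 1))"

(* The radial profile U(t,r), with the constant C still a parameter; meant for t > 0, r \<ge> 0. *)
definition barenblatt_profile ::
    "nat \<Rightarrow> real \<Rightarrow> real \<Rightarrow> real \<Rightarrow> real \<Rightarrow> real \<Rightarrow> real" where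
  "barenblatt_profile d p m C t r =
     t powr (- real d / barenblatt_beta d p m) *
     max (C - barenblatt_kappa d p m *
                (t powr (- 1 / barenblatt_beta d p m) * r) powr (p / (p - 1))) 0
       powr barenblatt_gamma p m"

definition barenblatt_const :: "nat \<Rightarrow> real \<Rightarrow> real \<Rightarrow> real" where
  "barenblatt_const d p m =
     (THE C. C > 0 \<and>
        (\<forall>t>0. sphere_area d *
                 (LBINT r:{0..}. barenblatt_profile d p m C t r * r ^ (d - 1)) = 1))"

definition barenblatt_solution ::
    "real \<Rightarrow> real \<Rightarrow> real ^ 'n \<Rightarrow> real \<Rightarrow> real ^ 'n \<Rightarrow> real" where
  "barenblatt_solution p m x t y =
     barenblatt_profile CARD('n) p m (barenblatt_const CARD('n) p m) t (norm (y - x))"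

(* h_t delta_x, as a measure on R^n; meant for t \<ge> 0. *)
definition barenblatt_flow :: "real \<Rightarrow> real \<Rightarrow> real \<Rightarrow> real ^ 'n \<Rightarrow> (real ^ 'n) measure" where
  "barenblatt_flow p m t x =
     (if t = 0 then return borel x
      else density lborel (\<lambda>y. ennreal (barenblatt_solution p m x t y)))"

definition dual_barenblatt_flow ::
    "real \<Rightarrow> real \<Rightarrow> real \<Rightarrow> (real ^ 'n \<Rightarrow> real) \<Rightarrow> real ^ 'n \<Rightarrow> real" where
  "dual_barenblatt_flow p m t f x = (\<integral>y. f y \<partial>barenblatt_flow p m t x)"

end

theory Submission
  imports Defs
begin

text \<open>The Barenblatt profiles are translation invariant, so the flow started at \<open>x\<close> is the translate by
  \<open>x\<close> of a fixed probability measure \<open>\<mu>\<close> with bounded support, the flow started at the origin. Hence the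
  dual flow of \<open>f\<close> at \<open>x\<close> is \<open>\<integral>f (x + z) d\<mu>(z)\<close>, the gradient passes under the integral, and Jensen's
  inequality concludes. That \<open>\<mu>\<close> has mass one rests on the existence and uniqueness of the constant
  \<open>C\<close>: by scaling, the mass of the profile is a fixed positive multiple of a positive power of \<open>C\<close>,
  independently of \<open>t\<close>.\<close>

section \<open>Gradients and differentiation under the integral sign\<close>

text \<open>Since \<open>grad\<close> is a definite description, existence and uniqueness are both
  required. The gradient is assembled from the values of the derivative on \<open>Basis\<close>, and
  a vector is determined by its inner products.\<close>

lemma GDERIV_grad:
  fixes f :: "'a::euclidean_space \<Rightarrow> real"
  assumes "f differentiable (at x)"
  shows "GDERIV f x :> grad f x"
proof -
  obtain f' where f': "(f has_derivative f') (at x)"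
    using assms by (auto simp: differentiable_def)
  then interpret f': bounded_linear f'
    by (rule has_derivative_bounded_linear)
  define D where "D = (\<Sum>b\<in>Basis. f' b *\<^sub>R b)"
  have "f' h = h \<bullet> D" for h
  proof -
    have "f' h = f' (\<Sum>b\<in>Basis. (h \<bullet> b) *\<^sub>R b)"
      by (simp add: euclidean_representation)
    also have "\<dots> = h \<bullet> D"
      by (simp add: D_def f'.sum f'.scaleR inner_sum_right mult.commute)
    finally show ?thesis .
  qed
  then have "f' = (\<lambda>h. h \<bullet> D)" by auto
  with f' have "GDERIV f x :> D"
    by (simp add: gderiv_def)
  moreover have "E = D" if "GDERIV f x :> E" for E
  proof -
    have "(\<lambda>h. h \<bullet> E) = (\<lambda>h. h \<bullet> D)"
      using that \<open>GDERIV f x :> D\<close> unfolding gderiv_def by (rule has_derivative_unique)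
    then show ?thesis
      by (metis vector_eq_ldot)
  qed
  ultimately show ?thesis
    unfolding grad_def by (rule theI)
qed

lemma grad_eqI:
  fixes f :: "'a::euclidean_space \<Rightarrow> real"
  assumes "GDERIV f x :> D"
  shows "grad f x = D"
proof -
  have "f differentiable (at x)"
    using assms by (auto simp: gderiv_def differentiable_def)
  then have "(\<lambda>h. h \<bullet> grad f x) = (\<lambda>h. h \<bullet> D)"
    using GDERIV_grad assms unfolding gderiv_def by (blast intro: has_derivative_unique)
  then show ?thesis
    by (metis vector_eq_ldot)
qed

text \<open>Almost every \<open>x + z\<close> lies in the compact ball \<open>cball x R\<close>,
  where \<open>g\<close> is bounded, and the measure is finite.\<close>

lemma integrable_continuous_bounded_support:
  fixes g :: "'a::euclidean_space \<Rightarrow> 'b::{banach, second_countable_topology}"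
  assumes "prob_space M" and [measurable_cong]: "sets M = sets borel"
    and supp: "AE z in M. norm z \<le> R" and g: "continuous_on UNIV g"
  shows "integrable M (\<lambda>z. g (x + z))"
proof -
  interpret prob_space M by fact
  have "compact (g ` cball x R)"
    using g by (intro compact_continuous_image) (auto intro: continuous_on_subset)
  then obtain B where B: "\<And>y. y \<in> cball x R \<Longrightarrow> norm (g y) \<le> B"
    by (meson bounded_iff compact_imp_bounded imageI)
  have [measurable]: "g \<in> borel_measurable borel"
    using g by (rule borel_measurable_continuous_onI)
  show ?thesis
  proof (rule integrable_const_bound)
    show "AE z in M. norm (g (x + z)) \<le> B"
      using supp by eventually_elim (auto intro!: B simp: dist_norm)
  qed measurable
qed

text \<open>Uniform continuity of \<open>grad f\<close> on a compact ball bounds the linearization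
  error of \<open>f\<close> at \<open>x + z\<close> by \<open>e * norm (y - x)\<close> for almost
  all \<open>z\<close> at once. Integrating this bound against a probability measure gives the
  derivative of the mean.\<close>

lemma GDERIV_integral_translate:
  fixes f :: "'a::euclidean_space \<Rightarrow> real"
  assumes M: "prob_space M" "sets M = sets borel" "AE z in M. norm z \<le> R"
    and f: "C1_function f"
  shows "GDERIV (\<lambda>x. \<integral>z. f (x + z) \<partial>M) x :> (\<integral>z. grad f (x + z) \<partial>M)"
proof -
  interpret prob_space M by fact
  have contg: "continuous_on UNIV (grad f)" and diff: "\<And>y. f differentiable (at y)"
    using f by (auto simp: C1_function_def)
  have contf: "continuous_on UNIV f"
    using diff by (auto intro!: continuous_at_imp_continuous_on differentiable_imp_continuous_within)
  note intf = integrable_continuous_bounded_support[OF M contf]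
  note intg = integrable_continuous_bounded_support[OF M contg]
  have deriv: "(f has_derivative (\<lambda>h. h \<bullet> grad f y)) (at y within S)" for y S
    using GDERIV_grad[OF diff] unfolding gderiv_def by (rule has_derivative_at_withinI)
  define G where "G = (\<integral>z. grad f (x + z) \<partial>M)"
  have "((\<lambda>x. \<integral>z. f (x + z) \<partial>M) has_derivative (\<lambda>h. h \<bullet> G)) (at x)"
    unfolding has_derivative_at_alt
  proof (intro conjI allI impI)
    show "bounded_linear (\<lambda>h. h \<bullet> G)"
      by (rule bounded_linear_inner_left)
    fix e :: real assume e: "0 < e"
    \<comment> \<open>The extra radius 1 makes room for the segments from \<open>x + z\<close> to
      \<open>y + z\<close> with \<open>norm z \<le> R\<close> and \<open>norm (y - x) < 1\<close>;
      hence \<open>min d 1\<close> below.\<close>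
    have "uniformly_continuous_on (cball x (R + 1)) (grad f)"
      by (intro compact_uniformly_continuous continuous_on_subset[OF contg]) auto
    then obtain d where d: "0 < d"
      and dd: "\<And>u v. u \<in> cball x (R + 1) \<Longrightarrow> v \<in> cball x (R + 1) \<Longrightarrow> dist v u < d
                \<Longrightarrow> dist (grad f v) (grad f u) < e"
      using uniformly_continuous_onE[OF _ e] by metis
    show "\<exists>d>0. \<forall>y. norm (y - x) < d \<longrightarrow>
      norm ((\<integral>z. f (y + z) \<partial>M) - (\<integral>z. f (x + z) \<partial>M) - (y - x) \<bullet> G) \<le> e * norm (y - x)"
    proof (intro exI[of _ "min d 1"] conjI allI impI)
      show "0 < min d 1" using d by simp
      fix y assume y: "norm (y - x) < min d 1"
      have bound: "AE z in M. norm (f (y + z) - f (x + z) - (y - x) \<bullet> grad f (x + z)) \<le> e * norm (y - x)"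
        using M(3)
      proof eventually_elim
        case (elim z)
        \<comment> \<open>Mean value inequality: the linearization error is controlled by the
          oscillation of the derivative on the ball around \<open>x + z\<close> of radius
          \<open>norm (y - x)\<close>.\<close>
        have "norm (f (y + z) - f (x + z) - ((y + z) - (x + z)) \<bullet> grad f (x + z))
              \<le> norm ((y + z) - (x + z)) * e"
        proof (rule differentiable_bound_linearization[where S = "cball (x + z) (norm (y - x))"
              and f' = "\<lambda>u h. h \<bullet> grad f u"])
          fix t :: real assume t: "t \<in> {0..1}"
          then have "t * norm (y - x) \<le> 1 * norm (y - x)"
            by (intro mult_right_mono) auto
          then show "x + z + t *\<^sub>R (y + z - (x + z)) \<in> cball (x + z) (norm (y - x))"
            using t by (simp add: dist_norm)
        next
          fix u assume u: "u \<in> cball (x + z) (norm (y - x))"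
          show "(f has_derivative (\<lambda>h. h \<bullet> grad f u)) (at u within cball (x + z) (norm (y - x)))"
            by (rule deriv)
          have uz: "norm (u - (x + z)) \<le> norm (y - x)"
            using u by (simp add: dist_norm norm_minus_commute)
          have "norm (u - x) \<le> norm (u - (x + z)) + norm z"
            using norm_triangle_ineq[of "u - (x + z)" z] by (simp add: algebra_simps)
          then have "u \<in> cball x (R + 1)"
            using uz y elim by (simp add: dist_norm norm_minus_commute)
          moreover have "x + z \<in> cball x (R + 1)"
            using elim by (simp add: dist_norm)
          moreover have "dist u (x + z) < d"
            using uz y by (simp add: dist_norm)
          ultimately have *: "norm (grad f u - grad f (x + z)) \<le> e"
            using dd[of "x + z" u] by (simp add: dist_norm)
          show "onorm ((\<lambda>h. h \<bullet> grad f u) - (\<lambda>h. h \<bullet> grad f (x + z))) \<le> e"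
          proof (rule onorm_le)
            fix h :: 'a
            have "norm (h \<bullet> (grad f u - grad f (x + z))) \<le> norm h * norm (grad f u - grad f (x + z))"
              by (metis Cauchy_Schwarz_ineq2 real_norm_def)
            also have "\<dots> \<le> norm h * e"
              using * by (intro mult_left_mono) auto
            finally show "norm (((\<lambda>h. h \<bullet> grad f u) - (\<lambda>h. h \<bullet> grad f (x + z))) h) \<le> e * norm h"
              by (simp add: inner_diff_right mult.commute)
          qed
        qed simp
        then show ?case
          by (simp add: mult.commute)
      qed
      have int: "integrable M (\<lambda>z. f (y + z) - f (x + z) - (y - x) \<bullet> grad f (x + z))"
        using intf intg by auto
      have "(\<integral>z. f (y + z) \<partial>M) - (\<integral>z. f (x + z) \<partial>M) - (y - x) \<bullet> G
            = (\<integral>z. f (y + z) - f (x + z) - (y - x) \<bullet> grad f (x + z) \<partial>M)"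
        using intf intg by (simp add: G_def)
      also have "norm \<dots> \<le> (\<integral>z. norm (f (y + z) - f (x + z) - (y - x) \<bullet> grad f (x + z)) \<partial>M)"
        by (rule integral_norm_bound)
      also have "\<dots> \<le> (\<integral>z. e * norm (y - x) \<partial>M)"
        using int bound by (intro integral_mono_AE) auto
      also have "\<dots> = e * norm (y - x)"
        by (simp add: prob_space)
      finally show "norm ((\<integral>z. f (y + z) \<partial>M) - (\<integral>z. f (x + z) \<partial>M) - (y - x) \<bullet> G) \<le> e * norm (y - x)" .
    qed
  qed
  then show ?thesis
    by (simp add: gderiv_def G_def)
qed

section \<open>Jensen's inequality for powers of a norm\<close>

text \<open>Young's inequality for \<open>u powr q\<close> and 1, with weights \<open>1 / q\<close>
  and \<open>1 - 1 / q\<close>, multiplied by \<open>q\<close>. It is applied to positive numbers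
  only, so \<open>u = 0\<close> is treated apart.\<close>

lemma Bernoulli_powr:
  fixes u q :: real
  assumes "0 \<le> u" "1 \<le> q"
  shows "1 + q * (u - 1) \<le> u powr q"
proof (cases "u = 0")
  case True
  then show ?thesis using assms by simp
next
  case False
  have "(u powr q) powr (1 / q) * 1 powr (1 - 1 / q) \<le> 1 / q * u powr q + (1 - 1 / q) * 1"
    using assms False by (intro Youngs_inequality_0) auto
  then have "u \<le> 1 / q * u powr q + (1 - 1 / q)"
    using assms by (simp add: powr_powr)
  then have "q * u \<le> q * (1 / q * u powr q + (1 - 1 / q))"
    using assms by (intro mult_left_mono) auto
  also have "\<dots> = u powr q + q - 1"
    using assms by (simp add: distrib_left right_diff_distrib)
  finally show ?thesis
    by (simp add: right_diff_distrib)
qed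

text \<open>The library's Jensen inequality needs an open interval on which the power is convex, but here the
  norm may vanish; hence the detour through the tangent line (Bernoulli) at the norm of the mean.\<close>

lemma (in prob_space) norm_expectation_powr_le:
  fixes g :: "'a \<Rightarrow> 'b::{banach, second_countable_topology}"
  assumes g: "integrable M g" and gq: "integrable M (\<lambda>z. norm (g z) powr q)" and q: "1 \<le> q"
  shows "norm (\<integral>z. g z \<partial>M) powr q \<le> (\<integral>z. norm (g z) powr q \<partial>M)"
proof -
  define a where "a = norm (\<integral>z. g z \<partial>M)"
  have a: "a \<le> (\<integral>z. norm (g z) \<partial>M)"
    unfolding a_def by (rule integral_norm_bound)
  show ?thesis
  proof (cases "a = 0")
    case True
    then show ?thesis by (simp add: a_def)
  next
    case False
    then have "0 < a" by (simp add: a_def)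
    \<comment> \<open>The right side is the tangent to the power at \<open>a\<close>, evaluated at
      the mean of the norm. The tangent is increasing and the mean is at least
      \<open>a\<close>.\<close>
    have "a powr q \<le> a powr q * (1 + q * ((\<integral>z. norm (g z) \<partial>M) / a - 1))"
      using a q \<open>0 < a\<close> by (simp add: field_simps)
    also have "\<dots> = (\<integral>z. a powr q * (1 + q * (norm (g z) / a - 1)) \<partial>M)"
      using g by (simp add: prob_space)
    also have "\<dots> \<le> (\<integral>z. norm (g z) powr q \<partial>M)"
    proof (rule integral_mono)
      show "integrable M (\<lambda>z. a powr q * (1 + q * (norm (g z) / a - 1)))"
        using g by auto
      fix z
      have "a powr q * (1 + q * (norm (g z) / a - 1)) \<le> a powr q * (norm (g z) / a) powr q"
        using \<open>0 < a\<close> q by (intro mult_left_mono Bernoulli_powr) auto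
      also have "\<dots> = norm (g z) powr q"
        using \<open>0 < a\<close> by (simp add: powr_divide)
      finally show "a powr q * (1 + q * (norm (g z) / a - 1)) \<le> norm (g z) powr q" .
    qed (rule gq)
    finally show ?thesis by (simp add: a_def)
  qed
qed

section \<open>Polar coordinates for radial functions\<close>

text \<open>Both measures give \<open>{..a}\<close> the volume of the ball of radius
  \<open>a\<close>. These half-lines are stable under intersection and generate the Borel sets, so
  the measures agree.\<close>

lemma distr_norm_lborel:
  "distr (lborel :: 'a::euclidean_space measure) borel norm =
     density lborel (\<lambda>r. ennreal (sphere_area DIM('a) * r ^ (DIM('a) - 1)) * indicator {0..} r)"
  (is "?L = ?R")
proof -
  have Suc: "Suc (DIM('a) - 1) = DIM('a)" by simp
  have V: "0 \<le> unit_ball_vol (real DIM('a))"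
    by (intro less_imp_le unit_ball_vol_pos) simp
  have L: "emeasure ?L {..a} = (if 0 \<le> a then ennreal (unit_ball_vol DIM('a) * a ^ DIM('a)) else 0)"
    for a
  proof -
    have "norm -` {..a} \<inter> space lborel = cball (0 :: 'a) a" by auto
    then have "emeasure ?L {..a} = emeasure lborel (cball (0 :: 'a) a)"
      by (simp add: emeasure_distr)
    then show ?thesis
      by (simp add: emeasure_cball)
  qed
  have R: "emeasure ?R {..a} = (if 0 \<le> a then ennreal (unit_ball_vol DIM('a) * a ^ DIM('a)) else 0)"
    for a
  proof -
    have "emeasure ?R {..a} =
      (\<integral>\<^sup>+r. ennreal (sphere_area DIM('a) * r ^ (DIM('a) - 1)) * indicator {0..a} r \<partial>lborel)"
      by (auto simp: emeasure_density intro!: nn_integral_cong split: split_indicator)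
    also have "\<dots> = (if 0 \<le> a then ennreal (unit_ball_vol DIM('a) * a ^ DIM('a)) else 0)"
    proof (cases "0 \<le> a")
      case True
      \<comment> \<open>The ball volume is an antiderivative of the sphere area; its value at 0
        vanishes because the dimension is positive.\<close>
      have "(\<integral>\<^sup>+r. ennreal (sphere_area DIM('a) * r ^ (DIM('a) - 1)) * indicator {0..a} r \<partial>lborel)
        = ennreal (unit_ball_vol DIM('a) * a ^ DIM('a) - unit_ball_vol DIM('a) * 0 ^ DIM('a))"
      proof (rule nn_integral_FTC_Icc)
        fix r :: real
        show "((\<lambda>r. unit_ball_vol DIM('a) * r ^ DIM('a)) has_real_derivative
              sphere_area DIM('a) * r ^ (DIM('a) - 1)) (at r)"
          unfolding sphere_area_def by (auto intro!: derivative_eq_intros)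
      qed (use True V in \<open>auto simp: sphere_area_def\<close>)
      then show ?thesis using True by simp
    qed (auto intro!: nn_integral_zero')
    finally show ?thesis .
  qed
  show ?thesis
  proof (rule measure_eqI_generator_eq[where \<Omega> = UNIV and E = "range atMost"
        and A = "\<lambda>n. {..real n}"])
    show "Int_stable (range (atMost :: real \<Rightarrow> real set))"
      by (auto simp: Int_stable_def)
    show "sets ?L = sigma_sets UNIV (range atMost)"
      by (simp add: borel_eq_atMost)
    show "sets ?R = sigma_sets UNIV (range atMost)"
      by (simp add: borel_eq_atMost)
    show "(\<Union>i. {..real i}) = UNIV"
      by (auto intro: real_arch_simple)
  qed (auto simp only: L R, auto)
qed

lemma nn_integral_radial:
  fixes g :: "real \<Rightarrow> ennreal"
  assumes [measurable]: "g \<in> borel_measurable borel"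
  shows "(\<integral>\<^sup>+y. g (norm (y :: 'a::euclidean_space)) \<partial>lborel) =
    (\<integral>\<^sup>+r. ennreal (sphere_area DIM('a) * r ^ (DIM('a) - 1)) * indicator {0..} r * g r \<partial>lborel)"
proof -
  have "(\<integral>\<^sup>+y. g (norm (y :: 'a)) \<partial>lborel) = (\<integral>\<^sup>+r. g r \<partial>distr (lborel :: 'a measure) borel norm)"
    by (simp add: nn_integral_distr)
  then show ?thesis
    by (simp add: distr_norm_lborel nn_integral_density)
qed

section \<open>Mass of the profile and the constant C\<close>

text \<open>This is the profile with \<open>C = 1\<close> at time \<open>t = 1\<close>, to which all
  others with \<open>C > 0\<close> reduce by scaling.\<close>

definition unit_barenblatt_profile :: "nat \<Rightarrow> real \<Rightarrow> real \<Rightarrow> real \<Rightarrow> real" where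
  "unit_barenblatt_profile d p m u =
     max (1 - barenblatt_kappa d p m * u powr (p / (p - 1))) 0 powr barenblatt_gamma p m"

locale barenblatt =
  fixes d :: nat and p m :: real
  assumes d: "1 \<le> d" and p: "1 < p" and m: "0 < m" and mp: "m * (p - 1) > 1"
begin

abbreviation "\<beta> \<equiv> barenblatt_beta d p m"
abbreviation "\<gamma> \<equiv> barenblatt_gamma p m"
abbreviation "\<kappa> \<equiv> barenblatt_kappa d p m"
abbreviation "g \<equiv> unit_barenblatt_profile d p m"

lemma beta_pos: "0 < \<beta>"
  unfolding barenblatt_beta_def using p mp by (intro add_pos_nonneg mult_nonneg_nonneg) auto

lemma gamma_pos: "0 < \<gamma>"
  unfolding barenblatt_gamma_def using p mp by auto

lemma kappa_pos: "0 < \<kappa>"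
  unfolding barenblatt_kappa_def using p m mp beta_pos by (intro mult_pos_pos divide_pos_pos) auto

text \<open>The factor \<open>C\<close> is pulled out of the truncated bracket. What remains is
  absorbed into the argument, because \<open>C powr (- (p - 1) / p)\<close> raised to
  \<open>p / (p - 1)\<close> is the inverse of \<open>C\<close>.\<close>

lemma profile_scaling:
  assumes C: "0 < C" and t: "0 < t" and r: "0 \<le> r"
  shows "barenblatt_profile d p m C t r =
    t powr (- real d / \<beta>) * C powr \<gamma> * g (t powr (- 1 / \<beta>) * C powr (- (p - 1) / p) * r)"
proof -
  have "C * (t powr (- 1 / \<beta>) * C powr (- (p - 1) / p) * r) powr (p / (p - 1))
      = C * (C powr (- (p - 1) / p)) powr (p / (p - 1)) * (t powr (- 1 / \<beta>) * r) powr (p / (p - 1))"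
    using r by (simp add: powr_mult mult_ac)
  also have "(C powr (- (p - 1) / p)) powr (p / (p - 1)) = C powr (- 1)"
  proof -
    have "- (p - 1) / p * (p / (p - 1)) = - 1" using p by (simp add: field_simps)
    then show ?thesis by (simp only: powr_powr)
  qed
  also have "C * C powr (- 1) = 1"
    using C by (simp add: powr_minus)
  finally have *: "C * (t powr (- 1 / \<beta>) * C powr (- (p - 1) / p) * r) powr (p / (p - 1))
      = (t powr (- 1 / \<beta>) * r) powr (p / (p - 1))"
    by simp
  have "max (C - \<kappa> * (t powr (- 1 / \<beta>) * r) powr (p / (p - 1))) 0
    = C * max (1 - \<kappa> * (t powr (- 1 / \<beta>) * C powr (- (p - 1) / p) * r) powr (p / (p - 1))) 0"
    unfolding *[symmetric] using C by (simp add: max_mult_distrib_left algebra_simps)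
  then show ?thesis
    unfolding barenblatt_profile_def unit_barenblatt_profile_def
    using C by (simp add: powr_mult)
qed

definition unit_mass :: real where
  "unit_mass = sphere_area d * (\<integral>u. indicator {0..} u * (g u * u ^ (d - 1)) \<partial>lborel)"

text \<open>The integrand is nonnegative, and positive on an interval of positive length, so its
  integral cannot vanish once it is known to be integrable.\<close>

lemma unit_mass_pos: "0 < unit_mass"
proof -
  \<comment> \<open>The edge of the support of \<open>g\<close>: the radius at which the bracket
    reaches 0.\<close>
  define R where "R = (1 / \<kappa>) powr ((p - 1) / p)"
  have "0 < R" using kappa_pos by (simp add: R_def)
  have R: "\<kappa> * R powr (p / (p - 1)) = 1"
    using kappa_pos p by (simp add: R_def powr_powr)
  have g0: "g u = 0" if "R \<le> u" for u
  proof -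
    have "\<kappa> * R powr (p / (p - 1)) \<le> \<kappa> * u powr (p / (p - 1))"
      using that \<open>0 < R\<close> kappa_pos p by (intro mult_left_mono powr_mono2) auto
    then show ?thesis
      using R by (simp add: unit_barenblatt_profile_def)
  qed
  have gpos: "0 < g u" if "0 \<le> u" "u < R" for u
  proof -
    have "\<kappa> * u powr (p / (p - 1)) < \<kappa> * R powr (p / (p - 1))"
      using that kappa_pos p by (intro mult_strict_left_mono powr_less_mono2) auto
    then show ?thesis
      using R by (simp add: unit_barenblatt_profile_def)
  qed
  have cont: "continuous_on {0..R} (\<lambda>u. g u * u ^ (d - 1))"
    unfolding unit_barenblatt_profile_def using p gamma_pos
    by (intro continuous_intros continuous_on_powr') auto
  \<comment> \<open>Integrability has to be secured, since a nonintegrable function has Bochner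
    integral 0 by convention.\<close>
  have "set_integrable lborel {0..R} (\<lambda>u. g u * u ^ (d - 1))"
    using cont by (rule borel_integrable_atLeastAtMost')
  moreover have eq: "indicator {0..R} u * (g u * u ^ (d - 1)) = indicator {0..} u * (g u * u ^ (d - 1))" for u
    using g0[of u] by (auto split: split_indicator)
  ultimately have int: "integrable lborel (\<lambda>u. indicator {0..} u * (g u * u ^ (d - 1)))"
    unfolding set_integrable_def real_scaleR_def by (simp only: eq)
  have nonneg: "0 \<le> indicator {0..} u * (g u * u ^ (d - 1))" for u
    by (auto simp: unit_barenblatt_profile_def split: split_indicator)
  have "(\<integral>u. indicator {0..} u * (g u * u ^ (d - 1)) \<partial>lborel) \<noteq> 0"
  proof
    assume "(\<integral>u. indicator {0..} u * (g u * u ^ (d - 1)) \<partial>lborel) = 0"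
    then have "AE u in lborel. indicator {0..} u * (g u * u ^ (d - 1)) = 0"
      using integral_nonneg_eq_0_iff_AE[OF int] nonneg by simp
    \<comment> \<open>The interval is open at 0 because \<open>u ^ (d - 1)\<close> vanishes there
      when \<open>d > 1\<close>.\<close>
    then have "AE u in lborel. u \<notin> {0<..<R}"
    proof eventually_elim
      case (elim u)
      then show ?case using gpos[of u] by auto
    qed
    then have "emeasure lborel {0<..<R} = 0"
      using AE_iff_null_sets[of "{0<..<R}" lborel] by auto
    with \<open>0 < R\<close> show False by simp
  qed
  moreover have "0 \<le> (\<integral>u. indicator {0..} u * (g u * u ^ (d - 1)) \<partial>lborel)"
    using nonneg by (intro integral_nonneg_AE) auto
  moreover have "0 < sphere_area d"
    using d by (auto simp: sphere_area_def)
  ultimately show ?thesis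
    unfolding unit_mass_def by auto
qed

text \<open>After scaling, the substitution \<open>u = c * r\<close> produces a factor
  \<open>c ^ d\<close> whose power of \<open>t\<close> is exactly the prefactor of the profile, so
  time cancels and only a power of \<open>C\<close> is left.\<close>

lemma profile_mass:
  assumes C: "0 < C" and t: "0 < t"
  shows "sphere_area d * (LBINT r:{0..}. barenblatt_profile d p m C t r * r ^ (d - 1))
    = C powr (\<gamma> + real d * (p - 1) / p) * unit_mass"
proof -
  define c where "c = t powr (- 1 / \<beta>) * C powr (- (p - 1) / p)"
  have "0 < c" using C t by (simp add: c_def)
  have cd: "c ^ d = t powr (- real d / \<beta>) * C powr (- real d * (p - 1) / p)"
  proof -
    have "c ^ d = (t powr (- 1 / \<beta>)) powr real d * (C powr (- (p - 1) / p)) powr real d"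
      unfolding c_def using C t by (simp add: power_mult_distrib powr_realpow)
    moreover have "- 1 / \<beta> * real d = - real d / \<beta>" "- (p - 1) / p * real d = - real d * (p - 1) / p"
      by (simp_all add: field_simps)
    ultimately show ?thesis
      by (simp only: powr_powr)
  qed
  have "(\<integral>u. indicator {0..} u * (g u * u ^ (d - 1)) \<partial>lborel)
      = c * (\<integral>r. indicator {0..} (c * r) * (g (c * r) * (c * r) ^ (d - 1)) \<partial>lborel)"
    using lborel_integral_real_affine[of c "\<lambda>u. indicator {0..} u * (g u * u ^ (d - 1))" 0] \<open>0 < c\<close>
    by simp
  also have "(\<lambda>r. indicator {0..} (c * r) * (g (c * r) * (c * r) ^ (d - 1)))
      = (\<lambda>r. c ^ (d - 1) * (indicator {0..} r * (g (c * r) * r ^ (d - 1))))"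
    using \<open>0 < c\<close> by (auto simp: fun_eq_iff power_mult_distrib zero_le_mult_iff split: split_indicator)
  also have "c * (\<integral>r. c ^ (d - 1) * (indicator {0..} r * (g (c * r) * r ^ (d - 1))) \<partial>lborel)
      = c ^ d * (\<integral>r. indicator {0..} r * (g (c * r) * r ^ (d - 1)) \<partial>lborel)"
    using d by (simp add: power_eq_if)
  finally have scale: "(\<integral>u. indicator {0..} u * (g u * u ^ (d - 1)) \<partial>lborel)
      = c ^ d * (\<integral>r. indicator {0..} r * (g (c * r) * r ^ (d - 1)) \<partial>lborel)" .
  have "(LBINT r:{0..}. barenblatt_profile d p m C t r * r ^ (d - 1))
      = (\<integral>r. (t powr (- real d / \<beta>) * C powr \<gamma>) * (indicator {0..} r * (g (c * r) * r ^ (d - 1))) \<partial>lborel)"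
    unfolding set_lebesgue_integral_def c_def
    by (intro Bochner_Integration.integral_cong)
      (auto simp: profile_scaling[OF C t] split: split_indicator)
  also have "\<dots> = C powr (\<gamma> + real d * (p - 1) / p) * c ^ d
      * (\<integral>r. indicator {0..} r * (g (c * r) * r ^ (d - 1)) \<partial>lborel)"
    unfolding cd using C by (simp add: powr_add[symmetric])
  finally show ?thesis
    unfolding unit_mass_def scale by simp
qed

text \<open>The mass condition reads \<open>C powr e * unit_mass = 1\<close> with
  \<open>e > 0\<close>, whatever the time. It has exactly one positive solution, which justifies the
  definite description.\<close>

lemma
  shows barenblatt_const_pos: "0 < barenblatt_const d p m"
    and barenblatt_const_mass: "\<And>t. 0 < t \<Longrightarrow> sphere_area d *
      (LBINT r:{0..}. barenblatt_profile d p m (barenblatt_const d p m) t r * r ^ (d - 1)) = 1"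
proof -
  define e where "e = \<gamma> + real d * (p - 1) / p"
  have "0 < e" unfolding e_def using gamma_pos p by (intro add_pos_nonneg) auto
  let ?P = "\<lambda>C. C > 0 \<and> (\<forall>t>0. sphere_area d *
      (LBINT r:{0..}. barenblatt_profile d p m C t r * r ^ (d - 1)) = 1)"
  have iff: "?P C \<longleftrightarrow> C = unit_mass powr (- 1 / e)" for C
  proof
    assume "?P C"
    \<comment> \<open>The single time \<open>t = 1\<close> already determines
      \<open>C\<close>.\<close>
    then have "0 < C" and "C powr e * unit_mass = 1"
      using profile_mass[of C 1] by (auto simp: e_def)
    then have "unit_mass = C powr (- e)"
      by (simp add: powr_minus field_simps)
    then have "unit_mass powr (- 1 / e) = C powr 1"
      using \<open>0 < e\<close> by (simp add: powr_powr)
    then show "C = unit_mass powr (- 1 / e)"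
      using \<open>0 < C\<close> by simp
  next
    assume C: "C = unit_mass powr (- 1 / e)"
    then have "0 < C" using unit_mass_pos by simp
    moreover have "C powr e * unit_mass = 1"
      unfolding C powr_powr using unit_mass_pos \<open>0 < e\<close> by (simp add: powr_minus)
    ultimately show "?P C"
      using profile_mass[of C] by (simp add: e_def)
  qed
  have "?P (barenblatt_const d p m)"
    unfolding barenblatt_const_def iff by simp
  then show "0 < barenblatt_const d p m"
    and "\<And>t. 0 < t \<Longrightarrow> sphere_area d *
      (LBINT r:{0..}. barenblatt_profile d p m (barenblatt_const d p m) t r * r ^ (d - 1)) = 1"
    by blast+
qed

lemma profile_bounded_support:
  assumes "0 < t"
  obtains R where "\<And>r. R < r \<Longrightarrow> barenblatt_profile d p m C t r = 0"
proof
  fix r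
  \<comment> \<open>This fixes the witness: the radius where the bracket reaches 0 if
    \<open>C \<ge> 0\<close>. Using \<open>max C 0\<close> keeps the base of the power nonnegative
    for every \<open>C\<close>.\<close>
  assume r: "t powr (1 / \<beta>) * (max C 0 / \<kappa>) powr ((p - 1) / p) < r"
  have "(max C 0 / \<kappa>) powr ((p - 1) / p) \<le> t powr (- 1 / \<beta>) * r"
    using r \<open>0 < t\<close> by (simp add: powr_minus field_simps)
  then have "((max C 0 / \<kappa>) powr ((p - 1) / p)) powr (p / (p - 1))
      \<le> (t powr (- 1 / \<beta>) * r) powr (p / (p - 1))"
    using p by (intro powr_mono2) auto
  then have "max C 0 / \<kappa> \<le> (t powr (- 1 / \<beta>) * r) powr (p / (p - 1))"
    using p kappa_pos by (simp add: powr_powr)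
  then have "C \<le> \<kappa> * (t powr (- 1 / \<beta>) * r) powr (p / (p - 1))"
    using kappa_pos by (simp add: field_simps)
  then show "barenblatt_profile d p m C t r = 0"
    by (simp add: barenblatt_profile_def)
qed

lemma profile_nonneg: "0 \<le> barenblatt_profile d p m C t r"
  by (simp add: barenblatt_profile_def)

lemma profile_measurable [measurable]: "barenblatt_profile d p m C t \<in> borel_measurable borel"
  unfolding barenblatt_profile_def by measurable

end

section \<open>The flow as translates of one probability measure\<close>

text \<open>Lebesgue measure is translation invariant and the density depends on
  \<open>y - x\<close> only; at time 0 a Dirac measure is translated.\<close>

lemma barenblatt_flow_eq_distr:
  fixes x :: "real ^ 'n"
  shows "barenblatt_flow p m t x = distr (barenblatt_flow p m t 0) borel ((+) x)"
proof (cases "t = 0")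
  case True
  then show ?thesis
    by (simp add: barenblatt_flow_def distr_return)
next
  case False
  have [measurable]: "barenblatt_solution p m x t \<in> borel_measurable borel"
    unfolding barenblatt_solution_def barenblatt_profile_def by measurable
  have "density lborel (\<lambda>y. ennreal (barenblatt_solution p m x t y))
    = density (distr lborel borel ((+) x)) (\<lambda>y. ennreal (barenblatt_solution p m x t y))"
    by (simp add: lborel_distr_plus)
  also have "\<dots> = distr (density lborel (\<lambda>z. ennreal (barenblatt_solution p m x t (x + z)))) borel ((+) x)"
    by (intro density_distr) measurable
  finally show ?thesis
    using False by (simp add: barenblatt_flow_def barenblatt_solution_def)
qed

lemma sets_barenblatt_flow [simp, measurable_cong]: "sets (barenblatt_flow p m t x) = sets borel"
  by (simp add: barenblatt_flow_def)

text \<open>This moves the dependence on \<open>x\<close> from the measure into the integrand, where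
  it can be differentiated.\<close>

lemma dual_barenblatt_flow_eq:
  fixes f :: "real ^ 'n \<Rightarrow> real"
  assumes [measurable]: "f \<in> borel_measurable borel"
  shows "dual_barenblatt_flow p m t f x = (\<integral>z. f (x + z) \<partial>barenblatt_flow p m t 0)"
  unfolding dual_barenblatt_flow_def by (subst barenblatt_flow_eq_distr) (simp add: integral_distr)

text \<open>At the origin, polar coordinates turn the normalisation of \<open>C\<close> into total
  mass one; translation carries this to every \<open>x\<close>.\<close>

lemma prob_space_barenblatt_flow:
  fixes x :: "real ^ 'n"
  assumes "1 < p" "0 < m" "m * (p - 1) > 1" "0 \<le> t"
  shows "prob_space (barenblatt_flow p m t x)"
proof (cases "t = 0")
  case True
  then show ?thesis
    by (simp add: barenblatt_flow_def prob_space_return)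
next
  case False
  with assms have t: "0 < t" by simp
  interpret barenblatt "CARD('n)" p m
    using assms by unfold_locales (auto simp: Suc_le_eq)
  let ?U = "barenblatt_profile CARD('n) p m (barenblatt_const CARD('n) p m) t"
  let ?h = "\<lambda>r. sphere_area CARD('n) * (indicator {0..} r * (?U r * r ^ (CARD('n) - 1)))"
  have mass: "(\<integral>r. ?h r \<partial>lborel) = 1"
    using barenblatt_const_mass[OF t] by (simp add: set_lebesgue_integral_def)
  \<comment> \<open>Otherwise the integral would be 0 by convention, not 1.\<close>
  then have int: "integrable lborel ?h"
    by (metis not_integrable_integral_eq zero_neq_one)
  have S: "0 \<le> sphere_area CARD('n)"
    by (simp add: sphere_area_def less_imp_le)
  have "(\<integral>\<^sup>+y. ennreal (?U (norm (y :: real ^ 'n))) \<partial>lborel)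
     = (\<integral>\<^sup>+r. ennreal (sphere_area CARD('n) * r ^ (CARD('n) - 1)) * indicator {0..} r * ennreal (?U r) \<partial>lborel)"
    by (subst nn_integral_radial) auto
  also have "\<dots> = (\<integral>\<^sup>+r. ennreal (?h r) \<partial>lborel)"
    using S by (intro nn_integral_cong)
      (auto simp: profile_nonneg ennreal_mult'[symmetric] ennreal_mult''[symmetric] mult_ac split: split_indicator)
  also have "\<dots> = ennreal (\<integral>r. ?h r \<partial>lborel)"
    using S by (intro nn_integral_eq_integral int AE_I2) (auto simp: profile_nonneg split: split_indicator)
  finally have 1: "(\<integral>\<^sup>+y. ennreal (?U (norm (y :: real ^ 'n))) \<partial>lborel) = 1"
    unfolding mass by simp
  have "prob_space (barenblatt_flow p m t (0 :: real ^ 'n))"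
    using 1 False
    by (intro prob_spaceI) (simp add: barenblatt_flow_def barenblatt_solution_def emeasure_density)
  then show ?thesis
    by (subst barenblatt_flow_eq_distr) (intro prob_space.prob_space_distr, auto)
qed

lemma barenblatt_flow_bounded_support:
  assumes "1 < p" "0 < m" "m * (p - 1) > 1" "0 \<le> t"
  obtains R where "AE z in barenblatt_flow p m t (0 :: real ^ 'n). norm z \<le> R"
proof (cases "t = 0")
  case True
  then have "AE z in barenblatt_flow p m t (0 :: real ^ 'n). norm z \<le> 0"
    unfolding barenblatt_flow_def by (subst if_P, simp, subst AE_return) auto
  then show ?thesis by (rule that)
next
  case False
  with assms have t: "0 < t" by simp
  interpret barenblatt "CARD('n)" p m
    using assms by unfold_locales (auto simp: Suc_le_eq)
  obtain R where R: "\<And>r. R < r \<Longrightarrow>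
      barenblatt_profile CARD('n) p m (barenblatt_const CARD('n) p m) t r = 0"
    using profile_bounded_support[OF t] by metis
  have meas: "(\<lambda>z :: real ^ 'n. ennreal (barenblatt_solution p m 0 t z)) \<in> borel_measurable lborel"
    unfolding barenblatt_solution_def by measurable
  have "norm z \<le> R" if "0 < ennreal (barenblatt_solution p m 0 t z)" for z :: "real ^ 'n"
    using that R[of "norm z"] by (cases "norm z \<le> R") (auto simp: barenblatt_solution_def)
  then have "AE z in barenblatt_flow p m t (0 :: real ^ 'n). norm z \<le> R"
    unfolding barenblatt_flow_def if_not_P[OF False] AE_density[OF meas] by simp
  then show ?thesis by (rule that)
qed

section \<open>Gradient estimate for the dual flow\<close>

theorem theoremA4:
  fixes p m q' t :: real
    and f :: "real ^ 'n \<Rightarrow> real"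
    and x :: "real ^ 'n"
  assumes "1 < p" and "0 < m"
    and "m * (p - 1) > 1"
    and "real CARD('n) * p > real CARD('n) + 1"
    and "1 \<le> q'"
    and "C1_function f"
    and "0 \<le> t"
  shows "dual_barenblatt_flow p m t f differentiable (at x) \<and>
         norm (grad (dual_barenblatt_flow p m t f) x) powr q'
           \<le> dual_barenblatt_flow p m t (\<lambda>y. norm (grad f y) powr q') x"
proof -
  define M where "M = barenblatt_flow p m t (0 :: real ^ 'n)"
  obtain R where "AE z in M. norm z \<le> R"
    unfolding M_def using barenblatt_flow_bounded_support assms by blast
  then have M: "prob_space M" "sets M = sets borel" "AE z in M. norm z \<le> R"
    unfolding M_def using prob_space_barenblatt_flow assms by auto
  interpret prob_space M by fact
  have contg: "continuous_on UNIV (grad f)" and diff: "\<And>y. f differentiable (at y)"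
    using assms(6) by (auto simp: C1_function_def)
  have contf: "continuous_on UNIV f"
    using diff by (auto intro!: continuous_at_imp_continuous_on differentiable_imp_continuous_within)
  \<comment> \<open>Zeros of \<open>grad f\<close> are harmless since the exponent is
    positive.\<close>
  have contq: "continuous_on UNIV (\<lambda>y. norm (grad f y) powr q')"
    using contg assms(5) by (intro continuous_on_powr' continuous_intros) auto
  have flow: "dual_barenblatt_flow p m t h y = (\<integral>z. h (y + z) \<partial>M)"
    if "continuous_on UNIV h" for h :: "real ^ 'n \<Rightarrow> real" and y
    unfolding M_def using that by (intro dual_barenblatt_flow_eq borel_measurable_continuous_onI)
  have D: "GDERIV (dual_barenblatt_flow p m t f) x :> (\<integral>z. grad f (x + z) \<partial>M)"
    using GDERIV_integral_translate[OF M assms(6), of x] flow[OF contf] by presburger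
  have "norm (grad (dual_barenblatt_flow p m t f) x) powr q'
      = norm (\<integral>z. grad f (x + z) \<partial>M) powr q'"
    by (simp add: grad_eqI[OF D])
  also have "\<dots> \<le> (\<integral>z. norm (grad f (x + z)) powr q' \<partial>M)"
    by (intro norm_expectation_powr_le assms(5)
        integrable_continuous_bounded_support[OF M contg] integrable_continuous_bounded_support[OF M contq])
  also have "\<dots> = dual_barenblatt_flow p m t (\<lambda>y. norm (grad f y) powr q') x"
    by (simp add: flow[OF contq])
  \<comment> \<open>\<open>D\<close> also supplies the differentiability, so the gradient on the
    left is a genuine one.\<close>
  finally show ?thesis
    using D by (auto simp: gderiv_def differentiable_def)
qed

end
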